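(* Let $d\ge 1$ and let $A_1,A_2:\mathbb{R}^d\to\mathbb{R}^d$ be self-adjoint expansive linear maps. For $\mu=1,2$ let $C_\mu:\mathbb{R}^d\to\mathbb{R}^d$ be an invertible linear map such that $A_\mu=C_\mu J_\mu C_\mu^{-1}$, where $J_\mu=\mathrm{diag}(\lambda_1^{(\mu)},\dots,\lambda_d^{(\mu)})$ is a diagonal matrix with $\lambda_i^{(\mu)}\in\mathbb{R}$. Put $J'_\mu=\mathrm{diag}(|\lambda_1^{(\mu)}|,\dots,|\lambda_d^{(\mu)}|)$ and $A'_\mu=C_\mu J'_\mu C_\mu^{-1}$. Then $\mathcal{E}_{A_1}=\mathcal{E}_{A_2}$ if and only if there exists $t>0$ such that $(A'_1)^t=A'_2$.
   Context: $\mathbb{R}^d$ carries the Euclidean norm and $|\cdot|_d$ is $d$-dimensional Lebesgue measure; $B_r=\{\mathbf{x}\in\mathbb{R}^d:\|\mathbf{x}\|<r\}$. A linear map $A:\mathbb{R}^d\to\mathbb{R}^d$ is expansive if all its (complex) eigenvalues have absolute value greater than $1$. For an expansive linear map $A$, $\mathcal{E}_A$ is the family of all measurable sets $E\subset\mathbb{R}^d$ with $|E|_d>0$ for which the origin is a point of $A$-density, i.e. for all $r>0$, $$\lim_{j\to\infty}\frac{|E\cap A^{-j}B_r|_d}{|A^{-j}B_r|_d}=1.$$ Real powers: if $A=CJC^{-1}$ with $C$ invertible and $J$ diagonal with positive diagonal entries $\lambda_1,\dots,\lambda_d$, then $A^t=CJ^tC^{-1}$, where $J^t$ is the diagonal matrix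 with entries $\lambda_1^t,\dots,\lambda_d^t$. *)

theory Defs
  imports "HOL-Analysis.Analysis"
begin

(* Complex eigenvalues of a real linear map are those of its standard matrix, read over the
   complex numbers. *)
definition complex_eigenvalue :: "(real^'n \<Rightarrow> real^'n) \<Rightarrow> complex \<Rightarrow> bool" where
  "complex_eigenvalue A z \<longleftrightarrow>
     (\<exists>v::complex^'n. v \<noteq> 0 \<and> map_matrix complex_of_real (matrix A) *v v = z *s v)"

definition expansive :: "(real^'n \<Rightarrow> real^'n) \<Rightarrow> bool" where
  "expansive A \<longleftrightarrow> linear A \<and> (\<forall>z. complex_eigenvalue A z \<longrightarrow> cmod z > 1)"

definition self_adjoint :: "(real^'n \<Rightarrow> real^'n) \<Rightarrow> bool" where
  "self_adjoint A \<longleftrightarrow> linear A \<and> adjoint A = A"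

(* Expansive maps are bijective, so inv A is their genuine inverse.  Only E may have infinite
   measure; the sets occurring in the quotient are bounded, so the real-valued measure is the
   genuine one there. *)
definition density_sets :: "(real^'n \<Rightarrow> real^'n) \<Rightarrow> (real^'n) set set" where
  "density_sets A = {E. E \<in> sets lebesgue \<and> emeasure lebesgue E > 0 \<and>
     (\<forall>r>0. (\<lambda>j. measure lebesgue (E \<inter> (inv A ^^ j) ` ball 0 r)
                  / measure lebesgue ((inv A ^^ j) ` ball 0 r)) \<longlonglongrightarrow> 1)}"

definition diag_map :: "('n \<Rightarrow> real) \<Rightarrow> real^'n \<Rightarrow> real^'n" where
  "diag_map l x = (\<chi> i. l i * x $ i)"

definition invertible_linear :: "(real^'n \<Rightarrow> real^'n) \<Rightarrow> bool" where
  "invertible_linear C \<longleftrightarrow> linear C \<and> bij C"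

(* Real powers are specified through a diagonalisation with positive eigenvalues; the result does
   not depend on its choice, see lin_powr_eq below.  For other maps the value is unspecified. *)
definition lin_powr :: "(real^'n \<Rightarrow> real^'n) \<Rightarrow> real \<Rightarrow> real^'n \<Rightarrow> real^'n" where
  "lin_powr A t = (THE B. \<exists>C l. invertible_linear C \<and> (\<forall>i. l i > 0) \<and>
     A = C \<circ> diag_map l \<circ> inv C \<and> B = C \<circ> diag_map (\<lambda>i. l i powr t) \<circ> inv C)"

lemma diag_map_linear: "linear (diag_map l)"
  by (rule linearI) (simp_all add: diag_map_def vec_eq_iff algebra_simps)

lemma diag_map_axis: "diag_map l (axis j 1) = l j *\<^sub>R axis j 1"
  by (simp add: diag_map_def vec_eq_iff axis_def)

lemma diag_map_intertwine_powr:
  fixes M :: "real^'n \<Rightarrow> real^'n"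
  assumes M: "linear M"
    and eq: "M \<circ> diag_map l = diag_map m \<circ> M"
  shows "M \<circ> diag_map (\<lambda>i. l i powr t) = diag_map (\<lambda>i. m i powr t) \<circ> M"
proof -
  have on_axis: "(M \<circ> diag_map (\<lambda>i. l i powr t)) (axis j 1)
      = (diag_map (\<lambda>i. m i powr t) \<circ> M) (axis j 1)" for j
  proof -
    have "l j *\<^sub>R M (axis j 1) = diag_map m (M (axis j 1))"
      using fun_cong[OF eq, of "axis j 1"] by (simp add: diag_map_axis linear_scale[OF M])
    then have "l j * M (axis j 1) $ i = m i * M (axis j 1) $ i" for i
      by (simp add: diag_map_def vec_eq_iff)
    then have "l j powr t * M (axis j 1) $ i = m i powr t * M (axis j 1) $ i" for i
      by (cases "M (axis j 1) $ i = 0") (metis mult_cancel_right)+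
    then have "l j powr t *\<^sub>R M (axis j 1) = diag_map (\<lambda>i. m i powr t) (M (axis j 1))"
      by (simp add: diag_map_def vec_eq_iff)
    then show ?thesis by (simp add: diag_map_axis linear_scale[OF M])
  qed
  have "linear (M \<circ> diag_map (\<lambda>i. l i powr t))" "linear (diag_map (\<lambda>i. m i powr t) \<circ> M)"
    using M diag_map_linear linear_compose by blast+
  then show ?thesis
    by (rule linear_eq_stdbasis) (auto simp: Basis_vec_def simp del: o_apply intro: on_axis)
qed

lemma diagonalisation_powr_unique:
  fixes C D :: "real^'n \<Rightarrow> real^'n"
  assumes C: "invertible_linear C" and D: "invertible_linear D"
    and eq: "C \<circ> diag_map l \<circ> inv C = D \<circ> diag_map m \<circ> inv D"
  shows "C \<circ> diag_map (\<lambda>i. l i powr t) \<circ> inv C = D \<circ> diag_map (\<lambda>i. m i powr t) \<circ> inv D"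
proof -
  have c: "inv C (C x) = x" "C (inv C x) = x" "inv D (D x) = x" "D (inv D x) = x" for x
    using C D by (simp_all add: invertible_linear_def bij_is_inj bij_is_surj surj_f_inv_f)
  have "linear (inv D)"
    using D by (metis invertible_linear_def bij_is_inj inj_linear_imp_inv_linear)
  then have M: "linear (inv D \<circ> C)"
    using C by (simp add: invertible_linear_def linear_compose)
  have "inv D (C (diag_map l x)) = diag_map m (inv D (C x))" for x
    using fun_cong[OF eq, of "C x"] by (simp add: c)
  then have "(inv D \<circ> C) \<circ> diag_map l = diag_map m \<circ> (inv D \<circ> C)"
    by (simp add: fun_eq_iff)
  from diag_map_intertwine_powr[OF M this]
  have *: "inv D (C (diag_map (\<lambda>i. l i powr t) x)) = diag_map (\<lambda>i. m i powr t) (inv D (C x))" for x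
    by (simp add: fun_eq_iff)
  show ?thesis
  proof
    fix x
    show "(C \<circ> diag_map (\<lambda>i. l i powr t) \<circ> inv C) x = (D \<circ> diag_map (\<lambda>i. m i powr t) \<circ> inv D) x"
      using *[of "inv C x"] by (simp add: c) (metis c(4))
  qed
qed

lemma lin_powr_eq:
  assumes "invertible_linear C" and "\<And>i. l i > 0"
  shows "lin_powr (C \<circ> diag_map l \<circ> inv C) t = C \<circ> diag_map (\<lambda>i. l i powr t) \<circ> inv C"
  unfolding lin_powr_def
proof (rule the_equality, use assms in blast)
  fix B
  assume "\<exists>D m. invertible_linear D \<and> (\<forall>i. m i > 0) \<and>
    C \<circ> diag_map l \<circ> inv C = D \<circ> diag_map m \<circ> inv D \<and>
    B = D \<circ> diag_map (\<lambda>i. m i powr t) \<circ> inv D"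
  then obtain D m where D: "invertible_linear D" "\<And>i. m i > 0"
    "C \<circ> diag_map l \<circ> inv C = D \<circ> diag_map m \<circ> inv D"
    "B = D \<circ> diag_map (\<lambda>i. m i powr t) \<circ> inv D"
    by blast
  show "B = C \<circ> diag_map (\<lambda>i. l i powr t) \<circ> inv C"
    unfolding D(4)
    by (rule diagonalisation_powr_unique[OF assms(1) D(1) D(3), symmetric])
qed

end

(* The maps |A1|, |A2| are self-adjoint with eigenvalues > 1, and passing from A to |A| does not
   change the family of density sets.  If |A2| = |A1|^t, the ellipsoids of A2 with index j lie in
   ellipsoids of A1 with index floor (t j) and boundedly larger volume, so the families agree.
   Conversely, the sets {x. |<x,v>|^s < |<x,u>|} detect growth rates: under A^-j the functional
   <x,u> decays like lead(u)^-j, where lead(u) is the least eigenvalue occurring in the expansion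
   of u, so such a set has density 1 or 0 according as lead(u) < lead(v)^s or lead(u) > lead(v)^s.
   Equal families thus force lead_2 = lead_1^t for a single t, and by orthogonality of the
   eigenspaces lead determines the map. *)

theory Submission
  imports Defs
begin

section \<open>Maps diagonalised by a fixed basis, their inverses and iterates\<close>

definition dconj :: "(real^'n \<Rightarrow> real^'n) \<Rightarrow> ('n \<Rightarrow> real) \<Rightarrow> real^'n \<Rightarrow> real^'n" where
  "dconj C l = C \<circ> diag_map l \<circ> inv C"

lemma inv_cancel:
  assumes "invertible_linear C"
  shows "inv C (C x) = x" "C (inv C x) = x"
  using assms by (simp_all add: invertible_linear_def bij_is_inj bij_is_surj surj_f_inv_f)

lemma linear_inv:
  assumes "invertible_linear C"
  shows "linear (inv C)"
  using assms by (metis invertible_linear_def bij_is_inj inj_linear_imp_inv_linear)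

lemma linear_dconj:
  assumes "invertible_linear C"
  shows "linear (dconj C l)"
  using assms linear_inv[OF assms] diag_map_linear linear_compose
  unfolding dconj_def invertible_linear_def by blast

lemma dconj_dconj:
  assumes "invertible_linear C"
  shows "dconj C l (dconj C m x) = dconj C (\<lambda>i. l i * m i) x"
  by (simp add: dconj_def inv_cancel[OF assms] diag_map_def mult.assoc)

lemma dconj_one:
  assumes "invertible_linear C"
  shows "dconj C (\<lambda>i. 1) x = x"
  by (simp add: dconj_def inv_cancel[OF assms] diag_map_def)

lemma inv_dconj:
  assumes "invertible_linear C" and "\<And>i. l i \<noteq> 0"
  shows "inv (dconj C l) = dconj C (\<lambda>i. inverse (l i))"
  using assms(2)
  by (intro inv_unique_comp) (auto simp: fun_eq_iff dconj_dconj[OF assms(1)] dconj_one[OF assms(1)])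

lemma funpow_dconj:
  assumes "invertible_linear C"
  shows "(dconj C l ^^ j) x = dconj C (\<lambda>i. l i ^ j) x"
  by (induction j) (simp_all add: dconj_dconj[OF assms] dconj_one[OF assms])

lemma funpow_inv_dconj:
  assumes "invertible_linear C" and "\<And>i. l i \<noteq> 0"
  shows "inv (dconj C l) ^^ j = dconj C (\<lambda>i. inverse (l i) ^ j)"
  by (rule ext) (simp add: inv_dconj[OF assms] funpow_dconj[OF assms(1)])

lemma norm_diag_map_le:
  assumes "\<And>i. \<bar>m i\<bar> \<le> 1"
  shows "norm (diag_map m x) \<le> norm x"
  unfolding norm_vec_def
  by (rule L2_set_mono) (auto simp: diag_map_def abs_mult intro!: mult_left_le_one_le assms)

text \<open>The product of operator bounds for \<open>C\<close> and \<open>inv C\<close> serves as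
  \<open>K\<close>. It does not depend on the multiplier \<open>m\<close>, which later varies with
  the iteration index.\<close>

lemma dconj_bounded:
  fixes C :: "real^'n \<Rightarrow> real^'n"
  assumes "invertible_linear C"
  obtains K where "K > 0"
    "\<And>m x. (\<And>i. \<bar>m i\<bar> \<le> 1) \<Longrightarrow> norm (dconj C m x) \<le> K * norm x"
proof -
  have C: "linear C" "linear (inv C)"
    using assms linear_inv[OF assms] by (auto simp: invertible_linear_def)
  obtain K1 where K1: "K1 > 0" "\<And>x. norm (C x) \<le> K1 * norm x"
    using linear_bounded_pos[OF C(1)] by blast
  obtain K2 where K2: "K2 > 0" "\<And>x. norm (inv C x) \<le> K2 * norm x"
    using linear_bounded_pos[OF C(2)] by blast
  have "norm (dconj C m x) \<le> (K1 * K2) * norm x" if "\<And>i. \<bar>m i\<bar> \<le> 1" for m x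
  proof -
    have "norm (dconj C m x) \<le> K1 * norm (diag_map m (inv C x))"
      by (simp add: dconj_def K1)
    also have "\<dots> \<le> K1 * (K2 * norm x)"
      using norm_diag_map_le[where m = m and x = "inv C x", OF that] K2(2)[of x] K1(1)
      by (intro mult_left_mono) linarith+
    finally show ?thesis by (simp add: mult.assoc)
  qed
  then show ?thesis
    using that[of "K1 * K2"] K1(1) K2(1) by simp
qed

section \<open>Lebesgue measure under linear maps\<close>

lemma measure_shear_cbox:
  fixes a b :: "real^'n"
  assumes "m \<noteq> n"
  shows "measure lebesgue ((\<lambda>x. \<chi> i. if i = m then x $ m + x $ n else x $ i) ` cbox a b)
    = measure lebesgue (cbox a b)"
proof (cases "cbox a b = {}")
  case False
  let ?h = "\<lambda>x::real^'n. \<chi> i. if i = m then x $ m + x $ n else x $ i"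
  \<comment> \<open>Moving the lower corner to 0 meets the sign condition of
    \<open>measure_shear_interval\<close>; by linearity the shear turns translation by
    \<open>a\<close> into translation by the sheared \<open>a\<close>.\<close>
  have box: "cbox a b = (+) a ` cbox 0 (b - a)"
    by (simp add: cbox_translation[symmetric])
  have ne: "cbox 0 (b - a) \<noteq> {}" using False box by auto
  have "?h ` cbox a b = (+) (?h a) ` ?h ` cbox 0 (b - a)"
    unfolding box image_image by (rule image_cong) (auto simp: vec_eq_iff)
  then have "measure lebesgue (?h ` cbox a b) = measure lebesgue (?h ` cbox 0 (b - a))"
    by (simp only: measure_translation)
  also have "\<dots> = measure lebesgue (cbox 0 (b - a))"
    by (rule measure_shear_interval[OF assms ne]) simp
  also have "\<dots> = measure lebesgue (cbox a b)"
    unfolding box by (rule measure_translation[symmetric])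
  finally show ?thesis .
qed simp

text \<open>The image is the box with transposed corners, so the product of side lengths is merely
  reindexed.\<close>

lemma measure_swap_cbox:
  fixes a b :: "real^'n"
  shows "measure lebesgue ((\<lambda>x. \<chi> i. x $ Transposition.transpose m n i) ` cbox a b)
    = measure lebesgue (cbox a b)"
proof -
  let ?p = "Transposition.transpose m n"
  let ?h = "\<lambda>x::real^'n. \<chi> i. x $ ?p i"
  have "?h ` cbox a b = cbox (?h a) (?h b)"
  proof (intro equalityI subsetI)
    fix y assume "y \<in> cbox (?h a) (?h b)"
    then have "a $ i \<le> ?h y $ i \<and> ?h y $ i \<le> b $ i" for i
      by (auto simp: mem_box_cart dest!: spec[of _ "?p i"])
    then have "?h y \<in> cbox a b" by (simp add: mem_box_cart)
    moreover have "?h (?h y) = y" by (simp add: vec_eq_iff)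
    ultimately show "y \<in> ?h ` cbox a b" by (metis imageI)
  qed (auto simp: mem_box_cart)
  moreover have "(\<Prod>i\<in>UNIV. b $ ?p i - a $ ?p i) = (\<Prod>i\<in>UNIV. b $ i - a $ i)"
    using prod.permute[OF permutes_swap_id[of m UNIV n], of "\<lambda>i. b $ i - a $ i"] by (simp add: o_def)
  moreover have "(\<forall>i. a $ ?p i \<le> b $ ?p i) \<longleftrightarrow> (\<forall>i. a $ i \<le> b $ i)"
    by (metis transpose_involutory)
  ultimately show ?thesis by (simp add: content_cbox_if_cart interval_eq_empty_cart not_less)
     (metis not_le transpose_involutory)
qed

text \<open>The library's \<open>measure_linear_image\<close> identifies the factor as the determinant, but needs a
  well-ordered index type.\<close>

lemma linear_image_measure_factor:
  fixes f :: "real^'n \<Rightarrow> real^'n"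
  assumes "linear f"
  shows "\<exists>c. \<forall>S \<in> lmeasurable. f ` S \<in> lmeasurable \<and> measure lebesgue (f ` S) = c * measure lebesgue S"
\<comment> \<open>Having a volume factor is preserved by composition, so it is enough to treat
  elementary maps: one output coordinate vanishing, a diagonal stretch, a coordinate swap, a
  shear.\<close>
proof (rule induct_linear_elementary[OF assms])
  fix f g :: "real^'n \<Rightarrow> real^'n"
  assume "\<exists>c. \<forall>S \<in> lmeasurable. f ` S \<in> lmeasurable \<and> measure lebesgue (f ` S) = c * measure lebesgue S"
    and "\<exists>c. \<forall>S \<in> lmeasurable. g ` S \<in> lmeasurable \<and> measure lebesgue (g ` S) = c * measure lebesgue S"
  then obtain c d where
    f: "\<And>S. S \<in> lmeasurable \<Longrightarrow> f ` S \<in> lmeasurable \<and> measure lebesgue (f ` S) = c * measure lebesgue S" and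
    g: "\<And>S. S \<in> lmeasurable \<Longrightarrow> g ` S \<in> lmeasurable \<and> measure lebesgue (g ` S) = d * measure lebesgue S"
    by blast
  have "(f \<circ> g) ` S \<in> lmeasurable \<and> measure lebesgue ((f \<circ> g) ` S) = (c * d) * measure lebesgue S"
    if "S \<in> lmeasurable" for S
    using f[of "g ` S"] g[OF that] by (simp add: image_comp)
  then show "\<exists>c. \<forall>S \<in> lmeasurable. (f \<circ> g) ` S \<in> lmeasurable \<and> measure lebesgue ((f \<circ> g) ` S) = c * measure lebesgue S"
    by blast
next
  fix f :: "real^'n \<Rightarrow> real^'n" and i
  assume f: "linear f" and 0: "\<And>x. f x $ i = 0"
  have "f x \<noteq> axis i 1" for x using 0[of x] by (auto simp: vec_eq_iff axis_def)
  then have "\<not> inj f" using linear_injective_imp_surjective[OF f] by (metis surjD)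
  then have "negligible (f ` S)" for S
    by (rule negligible_linear_singular_image[OF f])
  then show "\<exists>c. \<forall>S \<in> lmeasurable. f ` S \<in> lmeasurable \<and> measure lebesgue (f ` S) = c * measure lebesgue S"
    by (intro exI[of _ 0]) (simp add: negligible_iff_measure)
next
  fix c :: "'n \<Rightarrow> real"
  show "\<exists>d. \<forall>S \<in> lmeasurable. (\<lambda>x. \<chi> i. c i * x $ i) ` S \<in> lmeasurable \<and>
      measure lebesgue ((\<lambda>x. \<chi> i. c i * x $ i) ` S) = d * measure lebesgue S"
    by (intro exI[of _ "\<bar>prod c UNIV\<bar>"] ballI conjI measurable_stretch measure_stretch)
next
  fix m n :: 'n
  let ?h = "\<lambda>x::real^'n. \<chi> i. x $ Transposition.transpose m n i"
  have "linear ?h"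
    by (rule linearI) (auto simp: vec_eq_iff algebra_simps)
  then have "?h ` S \<in> lmeasurable \<and> 1 * measure lebesgue S = measure lebesgue (?h ` S)"
    if "S \<in> lmeasurable" for S
    by (rule measure_linear_sufficient[OF _ that]) (simp only: measure_swap_cbox mult_1)
  then show "\<exists>c. \<forall>S \<in> lmeasurable. ?h ` S \<in> lmeasurable \<and> measure lebesgue (?h ` S) = c * measure lebesgue S"
    by (metis (lifting))
next
  fix m n :: 'n assume "m \<noteq> n"
  let ?h = "\<lambda>x::real^'n. \<chi> i. if i = m then x $ m + x $ n else x $ i"
  have "linear ?h"
    by (rule linearI) (auto simp: vec_eq_iff algebra_simps)
  then have "?h ` S \<in> lmeasurable \<and> 1 * measure lebesgue S = measure lebesgue (?h ` S)"
    if "S \<in> lmeasurable" for S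
    by (rule measure_linear_sufficient[OF _ that]) (simp only: measure_shear_cbox[OF \<open>m \<noteq> n\<close>] mult_1)
  then show "\<exists>c. \<forall>S \<in> lmeasurable. ?h ` S \<in> lmeasurable \<and> measure lebesgue (?h ` S) = c * measure lebesgue S"
    by (metis (lifting))
qed

text \<open>The volume factors of \<open>C\<close> and \<open>inv C\<close> multiply to 1, as the
  composition fixes the unit ball, whose volume is positive. Only the diagonal stretch
  remains.\<close>

lemma measure_dconj_image:
  fixes C :: "real^'n \<Rightarrow> real^'n"
  assumes C: "invertible_linear C" and S: "S \<in> lmeasurable"
  shows "dconj C m ` S \<in> lmeasurable"
    and "measure lebesgue (dconj C m ` S) = \<bar>\<Prod>i\<in>UNIV. m i\<bar> * measure lebesgue S"
proof -
  have lin: "linear C" "linear (inv C)"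
    using C linear_inv[OF C] by (auto simp: invertible_linear_def)
  obtain c where c: "\<And>S. S \<in> lmeasurable \<Longrightarrow> C ` S \<in> lmeasurable"
    "\<And>S. S \<in> lmeasurable \<Longrightarrow> measure lebesgue (C ` S) = c * measure lebesgue S"
    using linear_image_measure_factor[OF lin(1)] by blast
  obtain d where d: "\<And>S. S \<in> lmeasurable \<Longrightarrow> inv C ` S \<in> lmeasurable"
    "\<And>S. S \<in> lmeasurable \<Longrightarrow> measure lebesgue (inv C ` S) = d * measure lebesgue S"
    using linear_image_measure_factor[OF lin(2)] by blast
  have "C ` inv C ` ball 0 1 = ball 0 1"
    by (simp add: image_image inv_cancel[OF C])
  then have "c * (d * measure lebesgue (ball (0::real^'n) 1)) = measure lebesgue (ball (0::real^'n) 1)"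
    using c(2)[OF d(1), of "ball 0 1"] d(2)[of "ball 0 1"] by simp
  then have cd: "c * d = 1"
    using content_ball_pos[of 1 "0::real^'n"] by (simp add: mult.assoc[symmetric])
  have im: "dconj C m ` S = C ` (\<lambda>x. \<chi> i. m i * x $ i) ` inv C ` S"
    by (simp add: dconj_def image_image diag_map_def)
  note st = measurable_stretch[OF d(1)[OF S], of m] measure_stretch[OF d(1)[OF S], of m]
  show "dconj C m ` S \<in> lmeasurable" unfolding im by (rule c(1)[OF st(1)])
  have "measure lebesgue (dconj C m ` S) = (c * d) * \<bar>prod m UNIV\<bar> * measure lebesgue S"
    unfolding im c(2)[OF st(1)] st(2) d(2)[OF S] by (simp add: ac_simps)
  then show "measure lebesgue (dconj C m ` S) = \<bar>\<Prod>i\<in>UNIV. m i\<bar> * measure lebesgue S"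
    by (simp add: cd)
qed

text \<open>Lets density 1 of \<open>E\<close> be handled as density 0 of its complement, for which
  upper estimates through larger sets suffice.\<close>

lemma density_ratio_complement:
  assumes "E \<in> sets lebesgue" and "X \<in> lmeasurable" and "measure lebesgue X \<noteq> 0"
  shows "measure lebesgue ((- E) \<inter> X) / measure lebesgue X
    = 1 - measure lebesgue (E \<inter> X) / measure lebesgue X"
proof -
  have m: "E \<inter> X \<in> lmeasurable" "(- E) \<inter> X \<in> lmeasurable"
    using fmeasurable_Int_fmeasurable[OF assms(2)] assms(1)
    by (metis Int_commute, metis Int_commute Compl_in_sets_lebesgue)
  have "measure lebesgue X = measure lebesgue (E \<inter> X \<union> (- E) \<inter> X)"
    by (rule arg_cong[where f = "measure lebesgue"]) auto
  also have "\<dots> = measure lebesgue (E \<inter> X) + measure lebesgue ((- E) \<inter> X)"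
    by (rule measure_Un_AE) (use m in auto)
  finally show ?thesis
    using assms(3) by (simp add: field_simps)
qed

section \<open>Eigenbases of self-adjoint and expansive maps\<close>

text \<open>The columns of \<open>C\<close> are eigenvectors of the map. \<open>C\<close> itself
  need not be orthogonal, since columns with a common eigenvalue may be oblique to each
  other.\<close>

lemma self_adjoint_orthogonal:
  assumes "invertible_linear C" and "self_adjoint (dconj C l)" and "l i \<noteq> l k"
  shows "C (axis i 1) \<bullet> C (axis k 1) = 0"
proof -
  have C: "linear C" using assms(1) by (simp add: invertible_linear_def)
  have e: "dconj C l (C (axis i 1)) = l i *\<^sub>R C (axis i 1)" for i
    by (simp add: dconj_def inv_cancel[OF assms(1)] diag_map_axis linear_scale[OF C])
  have "dconj C l (C (axis i 1)) \<bullet> C (axis k 1) = C (axis i 1) \<bullet> dconj C l (C (axis k 1))"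
    using assms(2) adjoint_works by (metis self_adjoint_def)
  then show ?thesis using assms(3) by (simp add: e)
qed

lemma linear_inner_expand:
  fixes C :: "real^'n \<Rightarrow> real^'n"
  assumes "linear C"
  shows "C p \<bullet> C q = (\<Sum>i\<in>UNIV. \<Sum>k\<in>UNIV. p $ i * q $ k * (C (axis i 1) \<bullet> C (axis k 1)))"
proof -
  have "C x = (\<Sum>i\<in>UNIV. x $ i *\<^sub>R C (axis i 1))" for x
    by (subst basis_expansion[symmetric, of x])
       (simp add: linear_sum[OF assms] linear_scale[OF assms] scalar_mult_eq_scaleR)
  then have "C p \<bullet> C q = (\<Sum>i\<in>UNIV. p $ i *\<^sub>R C (axis i 1)) \<bullet> (\<Sum>k\<in>UNIV. q $ k *\<^sub>R C (axis k 1))"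
    by metis
  then show ?thesis
    unfolding inner_sum_left by (simp add: inner_sum_right sum_distrib_left mult.assoc mult.left_commute)
qed

text \<open>Here \<open>z\<close> and \<open>w\<close> are coordinates in the eigenbasis; if no
  eigenvalue occurs in both, every term of the Gram expansion vanishes.\<close>

lemma self_adjoint_orthogonal_sum:
  fixes C :: "real^'n \<Rightarrow> real^'n"
  assumes "invertible_linear C" and "self_adjoint (dconj C l)"
    and "\<And>i k. z $ i \<noteq> 0 \<Longrightarrow> w $ k \<noteq> 0 \<Longrightarrow> l i \<noteq> l k"
  shows "C z \<bullet> C w = 0"
proof -
  have C: "linear C" using assms(1) by (simp add: invertible_linear_def)
  have "z $ i * w $ k * (C (axis i 1) \<bullet> C (axis k 1)) = 0" for i k
    using assms(3)[of i k] self_adjoint_orthogonal[OF assms(1,2), of i k] by auto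
  then show ?thesis
    unfolding linear_inner_expand[OF C, of z w] by (intro sum.neutral ballI)
qed

text \<open>Gram terms between columns of different eigenvalue vanish, and for a common eigenvalue
  the two multipliers agree, which is why the multiplier is taken as a function \<open>h\<close> of
  the eigenvalue. Absolute values and powers of inverses are the cases used.\<close>

lemma self_adjoint_dconj_fun:
  fixes C :: "real^'n \<Rightarrow> real^'n"
  assumes C: "invertible_linear C" and "self_adjoint (dconj C l)"
  shows "dconj C (\<lambda>i. h (l i)) x \<bullet> y = x \<bullet> dconj C (\<lambda>i. h (l i)) y"
proof -
  have lC: "linear C" using assms(1) by (simp add: invertible_linear_def)
  let ?p = "inv C x" and ?q = "inv C y" and ?d = "diag_map (\<lambda>i. h (l i))"
  have "h (l i) * ?p $ i * ?q $ k * (C (axis i 1) \<bullet> C (axis k 1))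
    = ?p $ i * (h (l k) * ?q $ k) * (C (axis i 1) \<bullet> C (axis k 1))" for i k
    using self_adjoint_orthogonal[OF assms, of i k] by (cases "l i = l k") auto
  then have "C (?d ?p) \<bullet> C ?q = C ?p \<bullet> C (?d ?q)"
    unfolding linear_inner_expand[OF lC, of "?d ?p" ?q] linear_inner_expand[OF lC, of ?p "?d ?q"]
    by (intro sum.cong refl) (simp add: diag_map_def)
  then show ?thesis by (simp add: dconj_def inv_cancel[OF C])
qed

lemma self_adjoint_dconj_comp:
  fixes C :: "real^'n \<Rightarrow> real^'n"
  assumes "invertible_linear C" and "self_adjoint (dconj C l)"
  shows "self_adjoint (dconj C (\<lambda>i. h (l i)))"
  unfolding self_adjoint_def
  by (intro conjI linear_dconj adjoint_unique assms(1)) (simp add: self_adjoint_dconj_fun[OF assms])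

text \<open>The column of \<open>C\<close> with index \<open>i\<close>, read as a complex vector, is
  an eigenvector of the complexified matrix for \<open>l i\<close>.\<close>

lemma expansive_dconj:
  fixes C :: "real^'n \<Rightarrow> real^'n"
  assumes C: "invertible_linear C" and "expansive (dconj C l)"
  shows "\<bar>l i\<bar> > 1"
proof -
  have lC: "linear C" using assms(1) by (simp add: invertible_linear_def)
  define v where "v = C (axis i 1)"
  have "v \<noteq> 0"
    using inv_cancel(1)[OF C] linear_0[OF lC] axis_eq_0_iff unfolding v_def 
    by (metis zero_neq_one)
  have "dconj C l v = l i *\<^sub>R v"
    by (simp add: v_def dconj_def inv_cancel[OF C] diag_map_axis linear_scale[OF lC])
  then have "matrix (dconj C l) *v v = l i *\<^sub>R v"
    by (simp add: matrix_works linear_matrix_vector_mul_eq linear_dconj[OF C])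
  then have ev: "(\<Sum>k\<in>UNIV. matrix (dconj C l) $ r $ k * v $ k) = l i * v $ r" for r
    by (simp add: matrix_vector_mult_def vec_eq_iff)
  define w :: "complex^'n" where "w = (\<chi> k. complex_of_real (v $ k))"
  have "w \<noteq> 0" using \<open>v \<noteq> 0\<close> by (auto simp: w_def vec_eq_iff)
  moreover have "map_matrix complex_of_real (matrix (dconj C l)) *v w = complex_of_real (l i) *s w"
    by (simp add: vec_eq_iff matrix_vector_mult_def map_matrix_def w_def flip: of_real_mult of_real_sum ev)
  ultimately have "complex_eigenvalue (dconj C l) (complex_of_real (l i))"
    unfolding complex_eigenvalue_def by blast
  then show ?thesis using assms(2) by (force simp: expansive_def)
qed

section \<open>Leading eigenvalues and the asymptotics of inverse iterates\<close>

text \<open>For positive eigenvalues the components with the smallest one decay slowest under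
  inverse iteration. For \<open>u = 0\<close> the minimum would range over the empty set, so later
  uses concern nonzero \<open>u\<close>.\<close>

definition lead :: "(real^'n \<Rightarrow> real^'n) \<Rightarrow> ('n \<Rightarrow> real) \<Rightarrow> real^'n \<Rightarrow> real" where
  "lead C l u = Min (l ` {i. inv C u $ i \<noteq> 0})"

lemma lead_le:
  assumes "inv C u $ k \<noteq> 0"
  shows "lead C l u \<le> l k"
  unfolding lead_def using assms by (intro Min_le) auto

lemma lead_cases:
  fixes C :: "real^'n \<Rightarrow> real^'n"
  assumes "invertible_linear C" and "u \<noteq> 0"
  obtains i where "inv C u $ i \<noteq> 0" "lead C l u = l i"
proof -
  have C: "linear C" using assms(1) by (simp add: invertible_linear_def)
  have "inv C u \<noteq> 0"
    using inv_cancel(2)[OF assms(1), of u] linear_0[OF C] assms(2) by auto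
  then have ne: "l ` {i. inv C u $ i \<noteq> 0} \<noteq> {}" by (auto simp: vec_eq_iff)
  have "Min (l ` {i. inv C u $ i \<noteq> 0}) \<in> l ` {i. inv C u $ i \<noteq> 0}"
    using ne by (intro Min_in) auto
  then obtain i where i: "inv C u $ i \<noteq> 0" "lead C l u = l i"
    by (auto simp: lead_def)
  with that show ?thesis by blast
qed

text \<open>After normalisation by the leading eigenvalue, the coordinates belonging to it stay
  constant, and all others are zero or decay geometrically. The limit is the component of
  \<open>u\<close> in the leading eigenspace, nonzero because the minimum is attained.\<close>

lemma lead_limit:
  fixes C :: "real^'n \<Rightarrow> real^'n"
  assumes C: "invertible_linear C" and u: "u \<noteq> 0" and l: "\<And>i. l i > 0"
  obtains w where "w \<noteq> 0"
    "(\<lambda>j. lead C l u ^ j *\<^sub>R dconj C (\<lambda>i. inverse (l i) ^ j) u) \<longlonglongrightarrow> w"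
proof -
  have lC: "linear C" using assms(1) by (simp add: invertible_linear_def)
  define y where "y = inv C u"
  obtain i where i: "y $ i \<noteq> 0" "lead C l u = l i"
    using lead_cases[OF C u] unfolding y_def by metis
  have le: "l i \<le> l k" if "y $ k \<noteq> 0" for k
    using lead_le[of C u k l] that i(2) by (simp add: y_def)
  define z where "z = (\<chi> k. if l k = l i then y $ k else 0)"
  have "z \<noteq> 0" using i(1) by (auto simp: z_def vec_eq_iff)
  then have "C z \<noteq> 0" 
    using inv_cancel(1)[OF C] linear_0[OF lC] by metis
  moreover have "(\<lambda>j. \<chi> k. (l i / l k) ^ j * y $ k) \<longlonglongrightarrow> z"
  proof (rule vec_tendstoI)
    fix k
    consider "y $ k = 0" | "l k = l i" | "l i < l k" "y $ k \<noteq> 0" using le[of k] by force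
    then show "(\<lambda>j. (\<chi> k. (l i / l k) ^ j * y $ k) $ k) \<longlonglongrightarrow> z $ k"
    proof cases
      case 1 then show ?thesis by (simp add: z_def)
    next
      case 2 then show ?thesis using l[of i] by (simp add: z_def)
    next
      case 3
      have "(\<lambda>j. (l i / l k) ^ j * y $ k) \<longlonglongrightarrow> 0 * y $ k"
        by (intro tendsto_mult tendsto_const LIMSEQ_power_zero) (use 3 l[of i] l[of k] in auto)
      then show ?thesis using 3 by (simp add: z_def)
    qed
  qed
  then have "(\<lambda>j. C (\<chi> k. (l i / l k) ^ j * y $ k)) \<longlonglongrightarrow> C z"
    by (rule bounded_linear.tendsto[OF linear_conv_bounded_linear[THEN iffD1, OF lC]])
  moreover have "C (\<chi> k. (l i / l k) ^ j * y $ k) = lead C l u ^ j *\<^sub>R dconj C (\<lambda>i. inverse (l i) ^ j) u" for j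
    unfolding dconj_def o_apply linear_scale[OF lC, symmetric] i(2)
    by (rule arg_cong[where f = C]) (simp add: vec_eq_iff diag_map_def y_def divide_inverse power_mult_distrib)
  ultimately show ?thesis using that by auto
qed

text \<open>Dominated convergence for indicator functions, with the indicator of \<open>B\<close> as
  integrable bound. The null set \<open>N\<close> makes room for points where membership need not
  settle; it will be a hyperplane.\<close>

lemma measure_tendsto:
  fixes S :: "nat \<Rightarrow> 'a::euclidean_space set"
  assumes "B \<in> lmeasurable" and "\<And>j. S j \<in> sets lebesgue" and "\<And>j. S j \<subseteq> B"
    and "S' \<in> sets lebesgue" and "negligible N"
    and "\<And>x. x \<in> B - N \<Longrightarrow> \<forall>\<^sub>F j in sequentially. x \<in> S j \<longleftrightarrow> x \<in> S'"
    and "S' \<subseteq> B"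
  shows "(\<lambda>j. measure lebesgue (S j)) \<longlonglongrightarrow> measure lebesgue S'"
proof -
  have "(\<lambda>j. integral\<^sup>L lebesgue (indicat_real (S j))) \<longlonglongrightarrow> integral\<^sup>L lebesgue (indicat_real S')"
  proof (rule integral_dominated_convergence)
    show "integrable lebesgue (indicat_real B)"
      using fmeasurableD[OF assms(1)] fmeasurableD2[OF assms(1)]
      by (intro integrable_real_indicator) (simp_all only: infinity_ennreal_def top.not_eq_extremum)
    show "AE x in lebesgue. (\<lambda>j. indicat_real (S j) x) \<longlonglongrightarrow> indicat_real S' x"
    proof (rule AE_I')
      show "N \<in> null_sets lebesgue" using assms(5) by (simp add: negligible_iff_null_sets)
      have "(\<lambda>j. indicat_real (S j) x) \<longlonglongrightarrow> indicat_real S' x" if "x \<notin> N" for x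
      proof (cases "x \<in> B")
        case True
        show ?thesis
          by (rule tendsto_eventually) (use assms(6)[of x] True that in \<open>auto elim: eventually_mono simp: indicator_def\<close>)
      next
        case False
        then have "indicat_real (S j) x = 0" "indicat_real S' x = 0" for j
          using assms(3,7) by (auto simp: indicator_def)
        then show ?thesis by simp
      qed
      then show "{x \<in> space lebesgue. \<not> (\<lambda>j. indicat_real (S j) x) \<longlonglongrightarrow> indicat_real S' x} \<subseteq> N"
        by blast
    qed
    show "AE x in lebesgue. norm (indicat_real (S j) x) \<le> indicat_real B x" for j
      using assms(3) by (auto simp: indicator_def)
  qed (use assms in auto)
  then show ?thesis by simp
qed

section \<open>Density sets under powers of the eigenvalue moduli\<close>

text \<open>Only the moduli of the eigenvalues are related, so the case \<open>t = 1\<close> also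
  removes signs. Each ellipsoid for \<open>b\<close> is covered by one for \<open>a\<close> of
  comparable volume, so density 0 of the complement carries over.\<close>

lemma density_sets_dconj_subset:
  fixes C :: "real^'n \<Rightarrow> real^'n"
  assumes C: "invertible_linear C" and t: "t > 0"
    and a: "\<And>i. \<bar>a i\<bar> > 1" and b: "\<And>i. \<bar>b i\<bar> = \<bar>a i\<bar> powr t"
  shows "density_sets (dconj C a) \<subseteq> density_sets (dconj C b)"
proof
  fix E assume E: "E \<in> density_sets (dconj C a)"
  have a0: "a i \<noteq> 0" for i using a[of i] by auto
  have b0: "b i \<noteq> 0" for i using b[of i] a[of i] by auto
  let ?\<mu> = "measure lebesgue"
  let ?X = "\<lambda>r j. (inv (dconj C a) ^^ j) ` ball 0 r"
  let ?Y = "\<lambda>r j. (inv (dconj C b) ^^ j) ` ball 0 r"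
  have Em: "E \<in> sets lebesgue" and Epos: "emeasure lebesgue E > 0"
    and lim: "\<And>r. r > 0 \<Longrightarrow> (\<lambda>j. ?\<mu> (E \<inter> ?X r j) / ?\<mu> (?X r j)) \<longlonglongrightarrow> 1"
    using E by (auto simp: density_sets_def)
  obtain K where K: "K > 0"
    and bd: "\<And>m x. (\<And>i. \<bar>m i\<bar> \<le> 1) \<Longrightarrow> norm (dconj C m x) \<le> K * norm x"
    using dconj_bounded[OF C] by blast
  have bpos: "?\<mu> (ball (0::real^'n) r) > 0" if "r > 0" for r
    using that by (simp add: content_ball_pos)
  have X: "?X r j \<in> lmeasurable" "?\<mu> (?X r j) = \<bar>\<Prod>i\<in>UNIV. inverse (a i) ^ j\<bar> * ?\<mu> (ball (0::real^'n) r)" for r j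
    using measure_dconj_image[OF C, of "ball 0 r"] by (simp_all add: funpow_inv_dconj[OF C a0])
  have Y: "?Y r j \<in> lmeasurable" "?\<mu> (?Y r j) = \<bar>\<Prod>i\<in>UNIV. inverse (b i) ^ j\<bar> * ?\<mu> (ball (0::real^'n) r)" for r j
    using measure_dconj_image[OF C, of "ball 0 r"] by (simp_all add: funpow_inv_dconj[OF C b0])
  have Xpos: "?\<mu> (?X r j) > 0" if "r > 0" for r j
    using bpos[OF that] by (simp add: X(2) a0)
  have Ypos: "?\<mu> (?Y r j) > 0" if "r > 0" for r j
    using bpos[OF that] by (simp add: Y(2) b0)
  \<comment> \<open>The integer part of \<open>t * real j\<close> matches the scales: in each
    coordinate the moduli of \<open>a i ^ k j\<close> and \<open>b i ^ j\<close> differ by at most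
    one factor \<open>\<bar>a i\<bar>\<close>.\<close>
  define k where "k j = nat \<lfloor>t * real j\<rfloor>" for j :: nat
  have kle: "real (k j) \<le> t * real j" "t * real j \<le> real (k j) + 1" for j
    using t by (auto simp: k_def)
  have k_lim: "filterlim k at_top sequentially"
  proof -
    have "filterlim (\<lambda>j. t * real j) at_top sequentially"
      using t by (intro filterlim_tendsto_pos_mult_at_top[OF tendsto_const]) 
         (auto intro: filterlim_real_sequentially)
    then have "filterlim (\<lambda>j. t * real j - 1) at_top sequentially"
      using filterlim_tendsto_add_at_top[OF tendsto_const[of "-1"]] by fastforce
    then have "filterlim (\<lambda>j. real (k j)) at_top sequentially"
      by (rule filterlim_at_top_mono) (use kle(2) in \<open>auto simp: algebra_simps\<close>)
    then show ?thesis
      by (simp add: filterlim_sequentially_iff_filterlim_real)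
  qed
  \<comment> \<open>The quotient of the two diagonal maps. The exponent in \<open>absm\<close> lies
    between -1 and 0: modulus at most 1 yields the inclusion of ellipsoids, modulus at least
    \<open>inverse \<bar>a i\<bar>\<close> the volume bound.\<close>
  define m where "m j i = a i ^ k j * inverse (b i) ^ j" for j i
  have absm: "\<bar>m j i\<bar> = \<bar>a i\<bar> powr (real (k j) - t * real j)" for i j
  proof -
    have "\<bar>m j i\<bar> = \<bar>a i\<bar> powr real (k j) / (\<bar>a i\<bar> powr t) powr real j"
      using a[of i] by (simp add: m_def abs_mult power_abs b powr_realpow power_inverse divide_inverse)
    then show ?thesis by (simp add: powr_powr powr_diff)
  qed
  have m1: "\<bar>m j i\<bar> \<le> 1" for i j
    unfolding absm using powr_mono[of "real (k j) - t * real j" 0 "\<bar>a i\<bar>"] kle(1)[of j] a[of i] a0[of i] by simp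
  have m2: "inverse \<bar>a i\<bar> \<le> \<bar>m j i\<bar>" for i j
    unfolding absm using powr_mono[of "-1" "real (k j) - t * real j" "\<bar>a i\<bar>"] kle(2)[of j] a[of i]
    by (simp add: powr_minus)
  have inv_b: "inverse (b i) ^ j = inverse (a i) ^ k j * m j i" for i j
    by (simp add: m_def a0 power_inverse)
  have sub: "?Y r j \<subseteq> ?X (K * r) (k j)" for r j
  proof -
    have "?Y r j = dconj C (\<lambda>i. inverse (a i) ^ k j) ` dconj C (m j) ` ball 0 r"
      by (simp add: funpow_inv_dconj[OF C b0] image_image dconj_dconj[OF C] inv_b)
    also have "\<dots> \<subseteq> dconj C (\<lambda>i. inverse (a i) ^ k j) ` ball 0 (K * r)"
    proof (intro image_mono subsetI)
      fix y assume "y \<in> dconj C (m j) ` ball 0 r"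
      then obtain x where x: "norm x < r" "y = dconj C (m j) x" by auto
      have "norm y \<le> K * norm x" using bd[of "m j" x] m1 x by blast
      also have "\<dots> < K * r" using x K by simp
      finally show "y \<in> ball 0 (K * r)" by simp
    qed
    finally show ?thesis by (simp add: funpow_inv_dconj[OF C a0])
  qed
  \<comment> \<open>A bound for the volume ratio that is uniform in \<open>j\<close>: the product of
    the \<open>a i\<close> absorbs the lost factor in each coordinate, the quotient of balls the
    change of radius from \<open>r\<close> to \<open>K * r\<close>.\<close>
  define M where "M r = \<bar>\<Prod>i\<in>UNIV. a i\<bar> * ?\<mu> (ball (0::real^'n) (K * r)) / ?\<mu> (ball (0::real^'n) r)" for r
  have meas: "?\<mu> (?X (K * r) (k j)) \<le> M r * ?\<mu> (?Y r j)" if "r > 0" for r j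
  proof -
    have "inverse \<bar>\<Prod>i\<in>UNIV. a i\<bar> \<le> \<bar>\<Prod>i\<in>UNIV. m j i\<bar>"
      unfolding abs_prod prod_inversef[symmetric, unfolded o_def] 
      by (rule prod_mono) (use m2 in auto)
    moreover have "\<bar>\<Prod>i\<in>UNIV. a i\<bar> > 0" using a0 by simp
    ultimately have 1: "1 \<le> \<bar>\<Prod>i\<in>UNIV. a i\<bar> * \<bar>\<Prod>i\<in>UNIV. m j i\<bar>"
      by (simp add: field_simps)
    let ?P = "\<bar>\<Prod>i\<in>UNIV. inverse (a i) ^ k j\<bar> * ?\<mu> (ball (0::real^'n) (K * r))"
    have "?P * 1 \<le> ?P * (\<bar>\<Prod>i\<in>UNIV. a i\<bar> * \<bar>\<Prod>i\<in>UNIV. m j i\<bar>)"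
      by (rule mult_left_mono[OF 1]) simp
    also have "\<dots> = M r * ?\<mu> (?Y r j)"
      using bpos[OF that] by (simp add: M_def Y(2) inv_b prod.distrib abs_mult)
    finally show ?thesis by (simp add: X(2))
  qed
  have "(\<lambda>j. ?\<mu> (E \<inter> ?Y r j) / ?\<mu> (?Y r j)) \<longlonglongrightarrow> 1" if r: "r > 0" for r
  proof -
    have Kr: "K * r > 0" using K r by simp
    let ?f = "\<lambda>j. ?\<mu> ((- E) \<inter> ?X (K * r) j) / ?\<mu> (?X (K * r) j)"
    \<comment> \<open>The inclusion bounds measures from above, hence the complement of
      \<open>E\<close>: its small share of the larger ellipsoid is at most \<open>M r\<close> times
      as large in the smaller one.\<close>
    have "?f \<longlonglongrightarrow> 1 - 1"
      by (subst density_ratio_complement[OF Em X(1) less_imp_neq[OF Xpos[OF Kr], symmetric]])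
         (intro tendsto_diff tendsto_const lim Kr)
    then have upper: "(\<lambda>j. M r * ?f (k j)) \<longlonglongrightarrow> M r * 0"
      by (intro tendsto_mult tendsto_const) (use k_lim filterlim_compose in fastforce)
    have le: "?\<mu> ((- E) \<inter> ?Y r j) / ?\<mu> (?Y r j) \<le> M r * ?f (k j)" for j
    proof -
      have "?\<mu> ((- E) \<inter> ?Y r j) \<le> ?\<mu> ((- E) \<inter> ?X (K * r) (k j))"
      proof (rule measure_mono_fmeasurable)
        have E': "- E \<in> sets lebesgue" using Em by (rule Compl_in_sets_lebesgue[THEN iffD2])
        show "- E \<inter> ?X (K * r) (k j) \<in> lmeasurable"
          by (subst Int_commute) (rule fmeasurable_Int_fmeasurable[OF X(1) E'])
        show "- E \<inter> ?Y r j \<in> sets lebesgue"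
          by (rule sets.Int[OF E' fmeasurableD[OF Y(1)]])
        show "- E \<inter> ?Y r j \<subseteq> - E \<inter> ?X (K * r) (k j)" using sub[of j r] by blast
      qed
      then have "?\<mu> ((- E) \<inter> ?Y r j) / ?\<mu> (?Y r j) \<le> ?\<mu> ((- E) \<inter> ?X (K * r) (k j)) / ?\<mu> (?Y r j)"
        by (simp add: divide_right_mono)
      also have "\<dots> = ?f (k j) * (?\<mu> (?X (K * r) (k j)) / ?\<mu> (?Y r j))"
        using Xpos[OF Kr, of "k j"] by simp
      also have "\<dots> \<le> ?f (k j) * M r"
        using meas[OF r, of j] Ypos[OF r, of j] by (intro mult_left_mono) (auto simp: field_simps)
      finally show ?thesis by (simp add: mult.commute)
    qed
    have "(\<lambda>j. ?\<mu> ((- E) \<inter> ?Y r j) / ?\<mu> (?Y r j)) \<longlonglongrightarrow> 0"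
    proof (rule tendsto_sandwich)
      show "\<forall>\<^sub>F j in sequentially. ?\<mu> ((- E) \<inter> ?Y r j) / ?\<mu> (?Y r j) \<le> M r * ?f (k j)"
        by (intro always_eventually allI le)
      show "\<forall>\<^sub>F j in sequentially. 0 \<le> ?\<mu> ((- E) \<inter> ?Y r j) / ?\<mu> (?Y r j)"
        by (intro always_eventually allI divide_nonneg_nonneg measure_nonneg)
      show "(\<lambda>j. M r * ?f (k j)) \<longlonglongrightarrow> 0" using upper by (simp only: mult_zero_right)
    qed (rule tendsto_const)
    then have "(\<lambda>j. 1 - ?\<mu> (E \<inter> ?Y r j) / ?\<mu> (?Y r j)) \<longlonglongrightarrow> 0"
      by (subst (asm) density_ratio_complement[OF Em Y(1) less_imp_neq[OF Ypos[OF r], symmetric]])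
    from tendsto_diff[OF tendsto_const[of 1] this] show ?thesis by simp
  qed
  then show "E \<in> density_sets (dconj C b)"
    using Em Epos by (simp add: density_sets_def)
qed

text \<open>Exchanging \<open>a\<close> and \<open>b\<close> replaces \<open>t\<close> by its
  reciprocal, so the one inclusion gives both.\<close>

lemma density_sets_dconj_powr:
  fixes C :: "real^'n \<Rightarrow> real^'n"
  assumes C: "invertible_linear C" and t: "t > 0"
    and a: "\<And>i. \<bar>a i\<bar> > 1" and b: "\<And>i. \<bar>b i\<bar> = \<bar>a i\<bar> powr t"
  shows "density_sets (dconj C a) = density_sets (dconj C b)"
proof
  show "density_sets (dconj C a) \<subseteq> density_sets (dconj C b)"
    by (rule density_sets_dconj_subset[where a = a and b = b, OF C t a b])
  show "density_sets (dconj C b) \<subseteq> density_sets (dconj C a)"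
  proof (rule density_sets_dconj_subset[where a = b and b = a and t = "1 / t", OF C])
    show "\<bar>b i\<bar> > 1" for i using b[of i] a[of i] t by (simp add: gr_one_powr)
    show "\<bar>a i\<bar> = \<bar>b i\<bar> powr (1 / t)" for i using b[of i] a[of i] t by (simp add: powr_powr)
  qed (use t in simp)
qed

section \<open>Comparison sets and their densities\<close>

definition comparison_set :: "'a::real_inner \<Rightarrow> 'a \<Rightarrow> real \<Rightarrow> 'a set" where
  "comparison_set u v a = {x. \<bar>x \<bullet> v\<bar> powr a < \<bar>x \<bullet> u\<bar>}"

lemma comparison_set_borel [measurable]:
  "comparison_set u v a \<in> sets (borel :: 'a::euclidean_space measure)"
  unfolding comparison_set_def by measurable

text \<open>Symmetry moves \<open>T\<close> from the point to \<open>u\<close> and \<open>v\<close>.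
  The condition then compares the normalised functionals \<open>p\<close> and \<open>q\<close>, with
  the normalising powers collected in the single factor \<open>(m / n powr a) ^ j\<close>.\<close>

lemma comparison_set_scaled_iff:
  assumes m: "m > 0" and n: "n > 0"
    and p: "p = m ^ j *\<^sub>R T u" and q: "q = n ^ j *\<^sub>R T v"
    and sa: "\<And>y. T x \<bullet> y = x \<bullet> T y"
  shows "T x \<in> comparison_set u v a \<longleftrightarrow> (m / n powr a) ^ j * \<bar>x \<bullet> q\<bar> powr a < \<bar>x \<bullet> p\<bar>"
proof -
  have 1: "\<bar>x \<bullet> p\<bar> = m ^ j * \<bar>T x \<bullet> u\<bar>"
    using m by (simp add: p sa abs_mult)
  have "\<bar>x \<bullet> q\<bar> = n ^ j * \<bar>T x \<bullet> v\<bar>"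
    using n by (simp add: q sa abs_mult)
  then have "\<bar>x \<bullet> q\<bar> powr a = (n powr a) ^ j * \<bar>T x \<bullet> v\<bar> powr a"
    using n by (simp add: powr_mult powr_power powr_powr mult.commute flip: powr_realpow)
  then have 2: "(m / n powr a) ^ j * \<bar>x \<bullet> q\<bar> powr a = m ^ j * \<bar>T x \<bullet> v\<bar> powr a"
    using n by (simp add: power_divide)
  show ?thesis
    unfolding comparison_set_def mem_Collect_eq 1 2 using m by simp
qed

text \<open>The normalised functionals converge, so the geometric factor decides membership as soon
  as the dominating limit functional is nonzero at \<open>x\<close>. The exceptional points form a
  hyperplane if that limit vector is nonzero.\<close>

lemma comparison_set_eventually:
  assumes m: "m > 0" and n: "n > 0" and a: "a > 0"
    and p: "(\<lambda>j. m ^ j *\<^sub>R T j u) \<longlonglongrightarrow> p" and q: "(\<lambda>j. n ^ j *\<^sub>R T j v) \<longlonglongrightarrow> q"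
    and sa: "\<And>j y. T j x \<bullet> y = x \<bullet> T j y"
  shows "m < n powr a \<Longrightarrow> x \<bullet> p \<noteq> 0 \<Longrightarrow> \<forall>\<^sub>F j in sequentially. T j x \<in> comparison_set u v a"
    and "m > n powr a \<Longrightarrow> x \<bullet> q \<noteq> 0 \<Longrightarrow> \<forall>\<^sub>F j in sequentially. T j x \<notin> comparison_set u v a"
proof -
  let ?p = "\<lambda>j. m ^ j *\<^sub>R T j u" and ?q = "\<lambda>j. n ^ j *\<^sub>R T j v"
  have P: "(\<lambda>j. \<bar>x \<bullet> ?p j\<bar>) \<longlonglongrightarrow> \<bar>x \<bullet> p\<bar>"
    by (intro tendsto_intros p)
  \<comment> \<open>The limit inner product with \<open>q\<close> may be 0; convergence of the power
    there rests on \<open>a > 0\<close>.\<close>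
  have Q: "(\<lambda>j. \<bar>x \<bullet> ?q j\<bar> powr a) \<longlonglongrightarrow> \<bar>x \<bullet> q\<bar> powr a"
    by (rule tendsto_powr'[OF tendsto_rabs[OF tendsto_inner[OF tendsto_const q]] tendsto_const]) (use a in simp)
  have iff: "T j x \<in> comparison_set u v a \<longleftrightarrow> (m / n powr a) ^ j * \<bar>x \<bullet> ?q j\<bar> powr a < \<bar>x \<bullet> ?p j\<bar>" for j
    by (rule comparison_set_scaled_iff[OF m n refl refl sa])
  have na: "n powr a > 0" using n by simp
  {
    assume less: "m < n powr a" and nz: "x \<bullet> p \<noteq> 0"
    have "(\<lambda>j. (m / n powr a) ^ j * \<bar>x \<bullet> ?q j\<bar> powr a) \<longlonglongrightarrow> 0 * \<bar>x \<bullet> q\<bar> powr a"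
      by (intro tendsto_mult LIMSEQ_power_zero Q) (use less m na in simp)
    from tendsto_diff[OF P this]
    have "(\<lambda>j. \<bar>x \<bullet> ?p j\<bar> - (m / n powr a) ^ j * \<bar>x \<bullet> ?q j\<bar> powr a) \<longlonglongrightarrow> \<bar>x \<bullet> p\<bar>"
      by simp
    then have "\<forall>\<^sub>F j in sequentially. 0 < \<bar>x \<bullet> ?p j\<bar> - (m / n powr a) ^ j * \<bar>x \<bullet> ?q j\<bar> powr a"
      by (rule order_tendstoD) (use nz in simp)
    then show "\<forall>\<^sub>F j in sequentially. T j x \<in> comparison_set u v a"
      by (rule eventually_mono) (simp add: iff)
  next
    assume gr: "m > n powr a" and nz: "x \<bullet> q \<noteq> 0"
    \<comment> \<open>Now the factor \<open>(m / n powr a) ^ j\<close> diverges, so the inequality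
      is divided by it before passing to the limit.\<close>
    have "(\<lambda>j. (n powr a / m) ^ j * \<bar>x \<bullet> ?p j\<bar>) \<longlonglongrightarrow> 0 * \<bar>x \<bullet> p\<bar>"
      by (intro tendsto_mult LIMSEQ_power_zero P) (use gr m n in \<open>simp add: abs_of_pos\<close>)
    from tendsto_diff[OF Q this]
    have "(\<lambda>j. \<bar>x \<bullet> ?q j\<bar> powr a - (n powr a / m) ^ j * \<bar>x \<bullet> ?p j\<bar>) \<longlonglongrightarrow> \<bar>x \<bullet> q\<bar> powr a"
      by simp
    then have "\<forall>\<^sub>F j in sequentially. 0 < \<bar>x \<bullet> ?q j\<bar> powr a - (n powr a / m) ^ j * \<bar>x \<bullet> ?p j\<bar>"
      by (rule order_tendstoD) (use nz in simp)
    then show "\<forall>\<^sub>F j in sequentially. T j x \<notin> comparison_set u v a"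
    proof (rule eventually_mono)
      fix j assume "0 < \<bar>x \<bullet> ?q j\<bar> powr a - (n powr a / m) ^ j * \<bar>x \<bullet> ?p j\<bar>"
      then have "(m / n powr a) ^ j * ((n powr a / m) ^ j * \<bar>x \<bullet> ?p j\<bar>) < (m / n powr a) ^ j * (\<bar>x \<bullet> ?q j\<bar> powr a)"
        using m na by (intro mult_strict_left_mono) simp_all
      moreover have "(m / n powr a) ^ j * (n powr a / m) ^ j = 1"
        using m na by (simp flip: power_mult_distrib)
      ultimately have "\<bar>x \<bullet> ?p j\<bar> < (m / n powr a) ^ j * (\<bar>x \<bullet> ?q j\<bar> powr a)"
        by (simp only: mult.assoc[symmetric] mult_1_left)
      then show "T j x \<notin> comparison_set u v a" by (simp add: iff)
    qed
  }
qed

lemma lead_gt_one: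
  fixes C :: "real^'n \<Rightarrow> real^'n"
  assumes "invertible_linear C" and "u \<noteq> 0" and "\<And>i. l i > 1"
  shows "lead C l u > 1"
  by (rule lead_cases[OF assms(1,2), of l]) (simp add: assms(3))

text \<open>Pulling back by the inverse iterates turns density into the share of a fixed ball whose
  points are mapped into the set. Off a hyperplane membership is eventually constant, so this share
  tends to 1 or to 0.\<close>

lemma comparison_set_density:
  fixes C :: "real^'n \<Rightarrow> real^'n"
  assumes C: "invertible_linear C" and sa: "self_adjoint (dconj C l)"
    and l: "\<And>i. l i > 1" and u: "u \<noteq> 0" and v: "v \<noteq> 0" and a: "a > 0"
  shows "lead C l u < lead C l v powr a \<Longrightarrow> comparison_set u v a \<in> density_sets (dconj C l)"
    and "lead C l u > lead C l v powr a \<Longrightarrow> comparison_set u v a \<notin> density_sets (dconj C l)"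
proof -
  have l0: "l i > 0" "l i \<noteq> 0" for i using l[of i] by auto
  have pos: "lead C l u > 0" "lead C l v > 0"
    using lead_gt_one[where l = l, OF C u l] lead_gt_one[where l = l, OF C v l] by auto
  define T where "T j = dconj C (\<lambda>i. inverse (l i) ^ j)" for j
  obtain p where p: "p \<noteq> 0" "(\<lambda>j. lead C l u ^ j *\<^sub>R T j u) \<longlonglongrightarrow> p"
    using lead_limit[where l = l, OF C u l0(1), folded T_def] by blast
  obtain q where q: "q \<noteq> 0" "(\<lambda>j. lead C l v ^ j *\<^sub>R T j v) \<longlonglongrightarrow> q"
    using lead_limit[where l = l, OF C v l0(1), folded T_def] by blast
  have saT: "T j x \<bullet> y = x \<bullet> T j y" for j x y
    unfolding T_def by (rule self_adjoint_dconj_fun[OF C sa])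
  let ?E = "comparison_set u v a" and ?\<mu> = "measure lebesgue"
  let ?B = "\<lambda>r. ball (0::real^'n) r"
  have contT: "continuous_on UNIV (T j)" for j
    unfolding T_def by (intro linear_continuous_on linear_conv_bounded_linear[THEN iffD1] linear_dconj C)
  have vimage: "{x. T j x \<in> ?E} \<in> sets borel" for j
    using measurable_sets[OF borel_measurable_continuous_onI[OF contT] comparison_set_borel]
    by (simp add: vimage_def)
  have S: "{x \<in> ?B r. T j x \<in> ?E} \<in> sets lebesgue" for r j
  proof -
    have "?B r \<inter> {x. T j x \<in> ?E} \<in> sets borel"
      by (rule sets.Int[OF borel_open[OF open_ball] vimage])
    moreover have "{x \<in> ?B r. T j x \<in> ?E} = ?B r \<inter> {x. T j x \<in> ?E}" by blast
    ultimately show ?thesis by simp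
  qed
  have Sm: "{x \<in> ?B r. T j x \<in> ?E} \<in> lmeasurable" for r j
    by (rule fmeasurableI2[OF lmeasurable_ball[of 0 r] _ S]) auto
  have Bpos: "?\<mu> (?B r) > 0" if "r > 0" for r
    using that by (simp add: content_ball_pos)
  have inv: "inv (dconj C l) ^^ j = T j" for j
    unfolding T_def by (rule funpow_inv_dconj[OF C l0(2)])
  \<comment> \<open>\<open>T j\<close> multiplies all volumes by the same nonzero factor, which
    cancels.\<close>
  have ratio: "?\<mu> (?E \<inter> (inv (dconj C l) ^^ j) ` ?B r) / ?\<mu> ((inv (dconj C l) ^^ j) ` ?B r)
      = ?\<mu> {x \<in> ?B r. T j x \<in> ?E} / ?\<mu> (?B r)" for r j
  proof -
    have "?E \<inter> T j ` ?B r = T j ` {x \<in> ?B r. T j x \<in> ?E}" by blast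
    then show ?thesis
      unfolding inv using measure_dconj_image(2)[OF C Sm] measure_dconj_image(2)[OF C, of "?B r"] l0
      by (simp add: T_def)
  qed
  {
    assume less: "lead C l u < lead C l v powr a"
    have lim: "(\<lambda>j. ?\<mu> {x \<in> ?B r. T j x \<in> ?E} / ?\<mu> (?B r)) \<longlonglongrightarrow> 1" if r: "r > 0" for r
    proof -
      have "(\<lambda>j. ?\<mu> {x \<in> ?B r. T j x \<in> ?E}) \<longlonglongrightarrow> ?\<mu> (?B r)"
      proof (rule measure_tendsto[OF lmeasurable_ball S])
        show "negligible {x. p \<bullet> x = 0}" using p by (intro negligible_hyperplane) simp
        fix x assume x: "x \<in> ?B r - {x. p \<bullet> x = 0}"
        then have "\<forall>\<^sub>F j in sequentially. T j x \<in> ?E"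
          by (intro comparison_set_eventually(1)[OF pos a p(2) q(2) saT less]) (simp add: inner_commute)
        then show "\<forall>\<^sub>F j in sequentially. x \<in> {x \<in> ?B r. T j x \<in> ?E} \<longleftrightarrow> x \<in> ?B r"
          using x by (auto elim: eventually_mono)
      qed auto
      then have "(\<lambda>j. ?\<mu> {x \<in> ?B r. T j x \<in> ?E} / ?\<mu> (?B r)) \<longlonglongrightarrow> ?\<mu> (?B r) / ?\<mu> (?B r)"
        by (intro tendsto_divide tendsto_const) (use Bpos[OF r] in auto)
      then show ?thesis using Bpos[OF r] by simp
    qed
    have "emeasure lebesgue ?E > 0"
    proof (rule ccontr)
      assume "\<not> emeasure lebesgue ?E > 0"
      then have "?E \<in> null_sets lebesgue" by (auto simp: null_sets_def)
      then have "?\<mu> (?E \<inter> X) = 0" for X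
        using negligible_Int negligible_iff_null_sets negligible_imp_measure0 by blast
      then have "(\<lambda>j. ?\<mu> {x \<in> ?B 1. T j x \<in> ?E} / ?\<mu> (?B 1)) = (\<lambda>j. 0)"
        unfolding ratio[symmetric] by simp
      with lim[of 1] have "(\<lambda>j::nat. 0::real) \<longlonglongrightarrow> 1" by simp
      then show False using LIMSEQ_unique tendsto_const by fastforce
    qed
    with lim show "?E \<in> density_sets (dconj C l)"
      unfolding density_sets_def mem_Collect_eq ratio by simp
  next
    assume gr: "lead C l u > lead C l v powr a"
    \<comment> \<open>One radius with limit 0 already refutes membership, so radius 1 is
      taken.\<close>
    have "(\<lambda>j. ?\<mu> {x \<in> ?B 1. T j x \<in> ?E}) \<longlonglongrightarrow> ?\<mu> ({}::(real^'n) set)"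
    proof (rule measure_tendsto[OF lmeasurable_ball S])
      show "negligible {x. q \<bullet> x = 0}" using q by (intro negligible_hyperplane) simp
      fix x assume x: "x \<in> ?B 1 - {x. q \<bullet> x = 0}"
      then have "\<forall>\<^sub>F j in sequentially. T j x \<notin> ?E"
        by (intro comparison_set_eventually(2)[OF pos a p(2) q(2) saT gr]) (simp add: inner_commute)
      then show "\<forall>\<^sub>F j in sequentially. x \<in> {x \<in> ?B 1. T j x \<in> ?E} \<longleftrightarrow> x \<in> {}"
        by (auto elim: eventually_mono)
    qed auto
    then have "(\<lambda>j. ?\<mu> {x \<in> ?B 1. T j x \<in> ?E} / ?\<mu> (?B 1)) \<longlonglongrightarrow> 0 / ?\<mu> (?B 1)"
      by (intro tendsto_divide tendsto_const) (use Bpos[of 1] in auto)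
    then have lim: "(\<lambda>j. ?\<mu> {x \<in> ?B 1. T j x \<in> ?E} / ?\<mu> (?B 1)) \<longlonglongrightarrow> 0" by simp
    show "?E \<notin> density_sets (dconj C l)"
    proof
      assume "?E \<in> density_sets (dconj C l)"
      then have "(\<lambda>j. ?\<mu> {x \<in> ?B 1. T j x \<in> ?E} / ?\<mu> (?B 1)) \<longlonglongrightarrow> 1"
        unfolding density_sets_def mem_Collect_eq ratio by simp
      from LIMSEQ_unique[OF this lim] show False by simp
    qed
  }
qed

section \<open>Recovering the exponent and the map from the density sets\<close>

text \<open>If the inequality failed, an exponent \<open>s\<close> strictly between the two ratios
  would give a comparison set that is a density set for the first map but not for the
  second.\<close>

lemma lead_ratio_le:
  fixes C D :: "real^'n \<Rightarrow> real^'n"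
  assumes C: "invertible_linear C" "self_adjoint (dconj C a)" "\<And>i. a i > 1"
    and D: "invertible_linear D" "self_adjoint (dconj D b)" "\<And>i. b i > 1"
    and dens: "density_sets (dconj C a) = density_sets (dconj D b)"
    and u: "u \<noteq> 0" and v: "v \<noteq> 0"
  shows "ln (lead D b u) / ln (lead D b v) \<le> ln (lead C a u) / ln (lead C a v)"
proof (rule ccontr)
  assume "\<not> ?thesis"
  then obtain s where s: "ln (lead C a u) / ln (lead C a v) < s" "s < ln (lead D b u) / ln (lead D b v)"
    using dense not_le by blast
  have gt: "lead C a u > 1" "lead C a v > 1" "lead D b u > 1" "lead D b v > 1"
    using lead_gt_one[where l = a, OF C(1) _ C(3)] lead_gt_one[where l = b, OF D(1) _ D(3)] u v by auto
  have "0 < ln (lead C a u) / ln (lead C a v)" using gt by simp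
  then have s0: "s > 0" using s by simp
  have "ln (lead C a u) < s * ln (lead C a v)" "s * ln (lead D b v) < ln (lead D b u)"
    using s gt by (simp_all add: field_simps)
  then have "lead C a u < lead C a v powr s" "lead D b u > lead D b v powr s"
    using gt by (simp_all add: powr_def) (metis exp_less_mono exp_ln less_trans zero_less_one)+
  with comparison_set_density(1)[OF C u v s0] comparison_set_density(2)[OF D u v s0] dens
  show False by blast
qed

text \<open>Applying the ratio inequality to \<open>u\<close> against a fixed reference vector
  \<open>w\<close>, and to \<open>w\<close> against \<open>u\<close>, gives equality. The exponent
  is therefore the quotient of logarithms at \<open>w\<close>.\<close>

lemma lead_powr:
  fixes C D :: "real^'n \<Rightarrow> real^'n"
  assumes C: "invertible_linear C" "self_adjoint (dconj C a)" "\<And>i. a i > 1"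
    and D: "invertible_linear D" "self_adjoint (dconj D b)" "\<And>i. b i > 1"
    and dens: "density_sets (dconj C a) = density_sets (dconj D b)"
  obtains t where "t > 0" "\<And>u. u \<noteq> 0 \<Longrightarrow> lead D b u = lead C a u powr t"
proof -
  obtain w :: "real^'n" where w: "w \<noteq> 0" using axis_eq_0_iff zero_neq_one by metis
  have pos: "ln (lead C a u) > 0" "ln (lead D b u) > 0" if "u \<noteq> 0" for u
    using lead_gt_one[where l = a, OF C(1) that C(3)] lead_gt_one[where l = b, OF D(1) that D(3)] by auto
  define t where "t = ln (lead D b w) / ln (lead C a w)"
  have "lead D b u = lead C a u powr t" if u: "u \<noteq> 0" for u
  proof -
    have "ln (lead D b u) / ln (lead D b w) \<le> ln (lead C a u) / ln (lead C a w)"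
      "ln (lead D b w) / ln (lead D b u) \<le> ln (lead C a w) / ln (lead C a u)"
      by (rule lead_ratio_le[OF C D dens u w], rule lead_ratio_le[OF C D dens w u])
    then have "ln (lead D b u) = t * ln (lead C a u)"
      using pos[OF u] pos[OF w] by (simp add: t_def field_simps)
    then show ?thesis
      using lead_gt_one[where l = a, OF C(1) u C(3)] lead_gt_one[where l = b, OF D(1) u D(3)] by (simp add: powr_def) (metis exp_ln less_trans zero_less_one)
  qed
  moreover have "t > 0" using pos[OF w] by (simp add: t_def)
  ultimately show ?thesis using that by blast
qed

text \<open>Every column of \<open>C\<close> turns out to be an eigenvector of both sides with the
  same eigenvalue. Orthogonality for each of the two self-adjoint maps rules out components outside
  the expected eigenspace of \<open>dconj D b\<close>.\<close>

lemma dconj_eq_powr: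
  fixes C D :: "real^'n \<Rightarrow> real^'n"
  assumes C: "invertible_linear C" "self_adjoint (dconj C a)" "\<And>i. a i > 1"
    and D: "invertible_linear D" "self_adjoint (dconj D b)"
    and t: "t > 0" and lead: "\<And>u. u \<noteq> 0 \<Longrightarrow> lead D b u = lead C a u powr t"
  shows "dconj D b = dconj C (\<lambda>i. a i powr t)"
proof -
  have lin: "linear C" "linear D"
    using C(1) D(1) by (auto simp: invertible_linear_def)
  have eig: "dconj D b (C (axis i 1)) = a i powr t *\<^sub>R C (axis i 1)" for i
  proof -
    define u where "u = C (axis i 1)"
    define d where "d = a i powr t"
    define y where "y = inv D u"
    have inv_u: "inv C u = axis i 1" by (simp add: u_def inv_cancel[OF C(1)])
    then have u: "u \<noteq> 0"
      using inv_cancel(1)[OF C(1), of 0] linear_0[OF lin(1)] axis_eq_0_iff[of i "1::real"] by auto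
    have lead_u: "lead C a u = a i"
      by (rule lead_cases[OF C(1) u, of a]) (auto simp: inv_u axis_def split: if_splits)
    \<comment> \<open>Splits \<open>u\<close> along the second map: \<open>D y0\<close> has
      eigenvalue \<open>d\<close>, while \<open>D y1\<close> collects all other eigenvalues and has
      to vanish.\<close>
    define y0 where "y0 = (\<chi> k. if b k = d then y $ k else 0)"
    define y1 where "y1 = (\<chi> k. if b k = d then 0 else y $ k)"
    have "y = y0 + y1" by (simp add: y0_def y1_def vec_eq_iff)
    then have u01: "u = D y0 + D y1"
      by (metis y_def inv_cancel(2)[OF D(1)] linear_add[OF lin(2)])
    have "D y1 = 0"
    proof (rule ccontr)
      assume u1: "D y1 \<noteq> 0"
      obtain k where k: "inv D (D y1) $ k \<noteq> 0" "lead D b (D y1) = b k"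
        using lead_cases[OF D(1) u1, of b] by blast
      then have k': "b k \<noteq> d" "y $ k \<noteq> 0"
        by (auto simp: inv_cancel[OF D(1)] y1_def split: if_splits)
      \<comment> \<open>The least eigenvalue of the second map occurring in \<open>u\<close> is
        \<open>d\<close>, so the different one \<open>b k\<close> exceeds it. The relation between
        the two leading eigenvalues carries this over to the first map.\<close>
      have "d \<le> b k"
        using lead_le[of D u k b] k'(2) unfolding y_def d_def lead[OF u] lead_u by simp
      with k' k lead[OF u1] have "a i powr t < lead C a (D y1) powr t"
        by (simp add: d_def)
      then have gt: "a i < lead C a (D y1)"
        using t lead_gt_one[where l = a, OF C(1) u1 C(3)] powr_mono2[of t "lead C a (D y1)" "a i"]
        by (cases "a i < lead C a (D y1)") auto
      \<comment> \<open>Only eigenvalues of the first map above \<open>a i\<close> occur in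
        \<open>D y1\<close>, so it is orthogonal to \<open>u\<close>. As it is also orthogonal to
        \<open>D y0\<close>, it is orthogonal to itself.\<close>
      have "C (axis i 1) \<bullet> C (inv C (D y1)) = 0"
      proof (rule self_adjoint_orthogonal_sum[OF C(1,2)])
        fix r s assume "axis i 1 $ r \<noteq> (0::real)" and s: "inv C (D y1) $ s \<noteq> 0"
        then have "r = i" by (auto simp: axis_def split: if_splits)
        moreover have "lead C a (D y1) \<le> a s"
          by (rule lead_le[OF s])
        ultimately show "a r \<noteq> a s" using gt by simp
      qed
      then have "u \<bullet> D y1 = 0" by (simp add: inv_cancel[OF C(1)] u_def)
      moreover have "D y0 \<bullet> D y1 = 0"
        by (rule self_adjoint_orthogonal_sum[OF D]) (auto simp: y0_def y1_def split: if_splits)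
      ultimately have "D y1 \<bullet> D y1 = 0" by (simp add: u01 inner_add_left)
      with u1 show False by simp
    qed
    then have "u = D y0" using u01 by simp
    moreover have "diag_map b y0 = d *\<^sub>R y0"
      by (simp add: diag_map_def y0_def vec_eq_iff)
    ultimately show ?thesis
      unfolding u_def[symmetric] d_def[symmetric]
      by (simp add: dconj_def inv_cancel[OF D(1)] linear_scale[OF lin(2)])
  qed
  have eig': "dconj C (\<lambda>i. a i powr t) (C (axis i 1)) = a i powr t *\<^sub>R C (axis i 1)" for i
    by (simp add: dconj_def inv_cancel[OF C(1)] diag_map_axis linear_scale[OF lin(1)])
  have "linear (dconj D b \<circ> C)" "linear (dconj C (\<lambda>i. a i powr t) \<circ> C)"
    using linear_dconj[OF D(1)] linear_dconj[OF C(1)] lin linear_compose by blast+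
  then have "dconj D b \<circ> C = dconj C (\<lambda>i. a i powr t) \<circ> C"
    by (rule linear_eq_stdbasis)
       (auto simp: Basis_vec_def eig eig')
  then have "dconj D b (C (inv C x)) = dconj C (\<lambda>i. a i powr t) (C (inv C x))" for x
    by (simp add: fun_eq_iff)
  then show ?thesis by (simp add: fun_eq_iff inv_cancel[OF C(1)])
qed

theorem corollary20:
  fixes A1 A2 C1 C2 A1' A2' :: "real^'n \<Rightarrow> real^'n"
    and l1 l2 :: "'n \<Rightarrow> real"
  assumes "self_adjoint A1" and "self_adjoint A2"
    and "expansive A1" and "expansive A2"
    and "invertible_linear C1" and "invertible_linear C2"
    and "A1 = C1 \<circ> diag_map l1 \<circ> inv C1"
    and "A2 = C2 \<circ> diag_map l2 \<circ> inv C2"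
    and "A1' = C1 \<circ> diag_map (\<lambda>i. \<bar>l1 i\<bar>) \<circ> inv C1"
    and "A2' = C2 \<circ> diag_map (\<lambda>i. \<bar>l2 i\<bar>) \<circ> inv C2"
  shows "density_sets A1 = density_sets A2 \<longleftrightarrow> (\<exists>t>0. lin_powr A1' t = A2')"
proof -
  note C1 = assms(5) and C2 = assms(6)
  let ?a = "\<lambda>i. \<bar>l1 i\<bar>" and ?b = "\<lambda>i. \<bar>l2 i\<bar>"
  have A: "A1 = dconj C1 l1" "A2 = dconj C2 l2" "A1' = dconj C1 ?a" "A2' = dconj C2 ?b"
    using assms(7-10) by (simp_all add: dconj_def)
  have a: "?a i > 1" and b: "?b i > 1" for i
    using expansive_dconj[OF C1] expansive_dconj[OF C2] assms(3,4) A by auto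
  have sa: "self_adjoint (dconj C1 ?a)" "self_adjoint (dconj C2 ?b)"
    using self_adjoint_dconj_comp[OF C1, of l1 abs] self_adjoint_dconj_comp[OF C2, of l2 abs] assms(1,2) A
    by auto
  \<comment> \<open>Exponent 1 compares moduli only, and so replaces the eigenvalues by their
    absolute values.\<close>
  have d1: "density_sets A1 = density_sets (dconj C1 ?a)"
    unfolding A by (rule density_sets_dconj_powr[OF C1, of 1]) (use a in \<open>auto simp: less_le_trans\<close>)
  have d2: "density_sets A2 = density_sets (dconj C2 ?b)"
    unfolding A by (rule density_sets_dconj_powr[OF C2, of 1]) (use b in \<open>auto simp: less_le_trans\<close>)
  \<comment> \<open>The real power is independent of the diagonalisation, so it may be computed in
    the basis given by \<open>C1\<close>.\<close>
  have pw: "lin_powr A1' t = dconj C1 (\<lambda>i. ?a i powr t)" for t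
    unfolding A dconj_def by (rule lin_powr_eq[OF C1]) (rule less_trans[OF zero_less_one a])
  show ?thesis
  proof
    assume "density_sets A1 = density_sets A2"
    then have "density_sets (dconj C1 ?a) = density_sets (dconj C2 ?b)" using d1 d2 by simp
    from lead_powr[OF C1 sa(1) a C2 sa(2) b this] obtain t
      where t: "t > 0" "\<And>u. u \<noteq> 0 \<Longrightarrow> lead C2 ?b u = lead C1 ?a u powr t" by blast
    have "dconj C2 ?b = dconj C1 (\<lambda>i. ?a i powr t)"
      by (rule dconj_eq_powr[OF C1 sa(1) a C2 sa(2) t])
    then show "\<exists>t>0. lin_powr A1' t = A2'" using t(1) pw A(4) by metis
  next
    assume "\<exists>t>0. lin_powr A1' t = A2'"
    then obtain t where t: "t > 0" "dconj C1 (\<lambda>i. ?a i powr t) = dconj C2 ?b"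
      using pw A(4) by metis
    have "density_sets (dconj C1 ?a) = density_sets (dconj C1 (\<lambda>i. ?a i powr t))"
      by (rule density_sets_dconj_powr[OF C1 t(1)]) (use a in auto)
    then show "density_sets A1 = density_sets A2" using d1 d2 t(2) by simp
  qed
qed

end
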